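(* Let $R$ be a finite commutative ring with unity and let $\Gamma'^{c}(R)$ be the complement unity product graph associated with $R$. If $|V(\Gamma'^{c}(R))|\geq 2$, then $\Gamma'^{c}(R)$ is connected.
   Context: For a ring $R$ with unity $e$, let $U(R)$ denote the set of units of $R$. The complement unity product graph $\Gamma'^{c}(R)$ is the simple graph with vertex set $V(\Gamma'^{c}(R))=U(R)$ in which two distinct vertices $r_i,r_j$ are adjacent if and only if $r_i\cdot r_j\neq e$. A graph is connected if there is a path between every two vertices. *)

theory Defs
  imports "HOL-Algebra.Ring" "Graph_Theory.Digraph_Component"
begin

text \<open>
  Simple graphs are represented, as in \<^theory>\<open>Graph_Theory.Digraph_Component\<close>, by symmetric
  loop-free digraphs without parallel arcs: an edge between \<open>r\<close> and \<open>s\<close> is the pair of arcs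
  \<open>(r, s)\<close> and \<open>(s, r)\<close>. That the arc relation below is symmetric is a property of units (a
  one-sided inverse of a unit is two-sided), proved as \<open>pair_graph_compl_unity_product_graph\<close>;
  commutativity is not needed for it.
\<close>

definition compl_unity_product_graph :: "('a, 'b) ring_scheme \<Rightarrow> 'a pair_pre_digraph" where
  "compl_unity_product_graph R =
     \<lparr> pverts = Units R,
       parcs = {(r, s). r \<in> Units R \<and> s \<in> Units R \<and> r \<noteq> s \<and> r \<otimes>\<^bsub>R\<^esub> s \<noteq> \<one>\<^bsub>R\<^esub>} \<rparr>"

lemma pair_graph_compl_unity_product_graph:
  assumes "ring R" and "finite (carrier R)"
  shows "pair_graph (compl_unity_product_graph R)"
proof -
  interpret ring R by fact
  have fin: "finite (Units R)"
    using assms(2) by (rule rev_finite_subset) auto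
  have comm: "s \<otimes>\<^bsub>R\<^esub> r = \<one>\<^bsub>R\<^esub>" if "r \<in> Units R" "s \<in> Units R" "r \<otimes>\<^bsub>R\<^esub> s = \<one>\<^bsub>R\<^esub>" for r s
    using that by (metis Units_closed Units_inv_closed Units_l_inv inv_unique)
  show ?thesis
  proof unfold_locales
    show "finite (parcs (compl_unity_product_graph R))"
      by (rule finite_subset[of _ "Units R \<times> Units R"])
        (auto simp: compl_unity_product_graph_def fin)
    show "symmetric (with_proj (compl_unity_product_graph R))"
      unfolding symmetric_def with_proj_simps
      by (rule symI) (use comm in \<open>auto simp: compl_unity_product_graph_def\<close>)
  qed (auto simp: compl_unity_product_graph_def fin)
qed

end

theory Submission
  imports Defs
begin

text \<open>
  The unity is joined to every other unit \<open>s\<close>, since \<open>\<one> \<otimes> s = s \<noteq> \<one>\<close>.  So the graph contains a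
  spanning star centred at the unity, and any two vertices are linked by a walk through the centre.
\<close>

lemma one_dominates_pair:
  assumes "cring R"
    and s: "s \<in> Units R" "s \<noteq> \<one>\<^bsub>R\<^esub>"
  shows "(\<one>\<^bsub>R\<^esub>, s) \<in> parcs (compl_unity_product_graph R)"
proof -
  interpret cring R by fact
  show ?thesis
    using s by (simp add: compl_unity_product_graph_def Units_closed)
qed

theorem theorem3p3:
  fixes R :: "('a, 'b) ring_scheme"
  assumes "cring R"
    and "finite (carrier R)"
    and "card (pverts (compl_unity_product_graph R)) \<ge> 2"
  shows "Digraph_Component.connected (with_proj (compl_unity_product_graph R))"
proof -
  interpret cring R by fact
  let ?G = "compl_unity_product_graph R"
  interpret pair_graph ?G
    by (rule pair_graph_compl_unity_product_graph[OF ring_axioms assms(2)])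
  have verts: "pverts ?G = Units R"
    by (simp add: compl_unity_product_graph_def)
  have from_one: "\<one>\<^bsub>R\<^esub> \<rightarrow>\<^sup>*\<^bsub>with_proj ?G\<^esub> s" if "s \<in> Units R" for s
  proof (cases "s = \<one>\<^bsub>R\<^esub>")
    case True
    with that show ?thesis
      by (simp add: verts)
  next
    case False
    with that one_dominates_pair[OF assms(1)] show ?thesis
      by auto
  qed
  have "r \<rightarrow>\<^sup>*\<^bsub>with_proj ?G\<^esub> s" if "r \<in> Units R" "s \<in> Units R" for r s
    using from_one that symmetric_reachable[OF sym_arcs] reachable_trans by metis
  then have "strongly_connected (mk_symmetric (with_proj ?G))"
    by (intro strongly_connectedI reachable_mk_symmetricI) (auto simp: verts)
  then show ?thesis
    by (simp add: connected_def)
qed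

end
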